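(* Let $p\in[1,\infty)$ and $T>0$. Let $W_n$ ($n\in\mathbb{N}$) be a sequence of graphs (identified with their step-graphons on $(0,1)^2$) and let $W$ be a graphon, all satisfying the standing graphon assumption, with $W_n,W\in L^\infty((0,1)^2)$ and $\|W_n-W\|_\infty\to 0$ as $n\to\infty$. Let $u_n\in C^1([0,T];L^p((0,1)))$ be the solution of the graph diffusion equation $\partial_t u_n=\mathcal{L}^{W_n}u_n$ with initial condition $u_n(\cdot,0)\in L^p((0,1))$, and let $u\in C^1([0,T];L^\infty((0,1)))$ be the solution of the graphon diffusion equation $\partial_t u=\mathcal{L}^{W}u$ with initial condition $u(\cdot,0)\in L^\infty((0,1))$. Then for all $n$ and all $t\in[0,T]$, $$\|u(\cdot,t)-u_n(\cdot,t)\|_\infty\le\|u(\cdot,0)-u_n(\cdot,0)\|_\infty+2t\,\|u(\cdot,0)\|_\infty\,\|W_n-W\|_\infty$$ (where $\|\cdot\|_\infty$ is the essential supremum norm, taking values in $[0,\infty]$).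
   Context: Standing graphon assumption (on every graph/graphon $W$): $W\in L^1((0,1)^2)$, $W(x,y)=W(y,x)\ge 0$ for all $(x,y)\in(0,1)^2$, and the degree $d_W(x):=\int_0^1 W(x,y)\,dy\le 1$ for a.e. $x\in(0,1)$. Graphs as graphons: a graph on $n$ nodes is weighted, undirected and simple, with symmetric adjacency matrix $(A^{(n)}_{ij})_{i,j=1}^n$; it is identified with the step-graphon $W_n(x,y)=A^{(n)}_{ij}$ for $(x,y)\in I_i\times I_j$, where $I_k=((k-1)/n,k/n]$ for $k\le n-1$ and $I_n=((n-1)/n,1)$. Diffusion operator: $\mathcal{L}^W u(x)=\int_0^1 W(x,y)\,(u(y)-u(x))\,dy$. It is a bounded linear operator on $L^p((0,1))$ for every $p\in[1,\infty]$ under the standing assumption. Solutions are classical: the equation holds as an identity in the given $L^p$ space for $t\in[0,T]$. *)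

theory Defs
  imports "HOL-Probability.Essential_Supremum"
begin

abbreviation unit_M :: "real measure" where
  "unit_M \<equiv> lebesgue_on {0<..<1}"

abbreviation square_M :: "(real \<times> real) measure" where
  "square_M \<equiv> lebesgue_on ({0<..<1} \<times> {0<..<1})"

text \<open>
  The \<open>L\<^sup>p\<close> norm for \<open>p \<in> [1,\<infinity>]\<close>, with values in \<open>[0,\<infinity>]\<close>. Elements of \<open>L\<^sup>p\<close> are represented by
  functions, so equality in \<open>L\<^sup>p\<close> is equality almost everywhere.
  The value is meaningful for measurable functions only.
\<close>

definition Lp_norm :: "ennreal \<Rightarrow> 'a measure \<Rightarrow> ('a \<Rightarrow> real) \<Rightarrow> ennreal" where
  "Lp_norm p M f =
     (if p = \<infinity> then esssup M (\<lambda>x. ennreal \<bar>f x\<bar>)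
      else let I = (\<integral>\<^sup>+ x. ennreal (\<bar>f x\<bar> powr enn2real p) \<partial>M)
           in if I = \<infinity> then \<infinity> else ennreal (enn2real I powr (1 / enn2real p)))"

definition Lp :: "ennreal \<Rightarrow> 'a measure \<Rightarrow> ('a \<Rightarrow> real) set" where
  "Lp p M = {f \<in> borel_measurable M. Lp_norm p M f < \<infinity>}"

definition degree :: "(real \<Rightarrow> real \<Rightarrow> real) \<Rightarrow> real \<Rightarrow> real" where
  "degree W x = (LINT y|unit_M. W x y)"

text \<open>
  Fubini makes the Bochner integral \<^term>\<open>degree W x\<close> the true degree for almost every \<open>x\<close>,
  as \<open>W\<close> is integrable on the square.
\<close>

definition graphon :: "(real \<Rightarrow> real \<Rightarrow> real) \<Rightarrow> bool" where
  "graphon W \<longleftrightarrow>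
     (\<lambda>(x, y). W x y) \<in> Lp 1 square_M \<and>
     (\<forall>x\<in>{0<..<1}. \<forall>y\<in>{0<..<1}. W x y = W y x \<and> W x y \<ge> 0) \<and>
     (AE x in unit_M. degree W x \<le> 1)"

definition simple_weighted_graph :: "nat \<Rightarrow> (nat \<Rightarrow> nat \<Rightarrow> real) \<Rightarrow> bool" where
  "simple_weighted_graph n A \<longleftrightarrow>
     (\<forall>i\<in>{1..n}. \<forall>j\<in>{1..n}. A i j = A j i) \<and> (\<forall>i\<in>{1..n}. A i i = 0)"

definition node_interval :: "nat \<Rightarrow> nat \<Rightarrow> real set" where
  "node_interval n k =
     (if k < n then {(real k - 1) / real n <.. real k / real n}
      else {(real n - 1) / real n <..< 1})"

text \<open>
  The intervals partition \<open>(0,1)\<close>, so for \<open>(x,y) \<in> I\<^sub>i \<times> I\<^sub>j\<close> the sum reduces to \<^term>\<open>A i j\<close>.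
\<close>

definition step_graphon :: "nat \<Rightarrow> (nat \<Rightarrow> nat \<Rightarrow> real) \<Rightarrow> real \<Rightarrow> real \<Rightarrow> real" where
  "step_graphon n A x y =
     (\<Sum>i=1..n. \<Sum>j=1..n. A i j * indicator (node_interval n i) x * indicator (node_interval n j) y)"

definition diffusion_op :: "(real \<Rightarrow> real \<Rightarrow> real) \<Rightarrow> (real \<Rightarrow> real) \<Rightarrow> real \<Rightarrow> real" where
  "diffusion_op W f x = (LINT y|unit_M. W x y * (f y - f x))"

text \<open>
  A time-dependent function is written \<open>u t x\<close> (time first), i.e. as a path \<open>t \<mapsto> u(\<cdot>,t)\<close> in \<open>L\<^sup>p\<close>.
  Limits in \<open>L\<^sup>p\<close> are limits of the norm of the difference; at the endpoints of \<open>[0,T]\<close> the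
  derivative is one-sided.
\<close>

definition Lp_continuous_on :: "ennreal \<Rightarrow> real set \<Rightarrow> (real \<Rightarrow> real \<Rightarrow> real) \<Rightarrow> bool" where
  "Lp_continuous_on p S v \<longleftrightarrow>
     (\<forall>t\<in>S. v t \<in> Lp p unit_M) \<and>
     (\<forall>t\<in>S. ((\<lambda>s. Lp_norm p unit_M (\<lambda>x. v s x - v t x)) \<longlongrightarrow> 0) (at t within S))"

definition has_Lp_derivative_on ::
  "ennreal \<Rightarrow> real set \<Rightarrow> (real \<Rightarrow> real \<Rightarrow> real) \<Rightarrow> (real \<Rightarrow> real \<Rightarrow> real) \<Rightarrow> bool" where
  "has_Lp_derivative_on p S u v \<longleftrightarrow>
     (\<forall>t\<in>S. u t \<in> Lp p unit_M \<and> v t \<in> Lp p unit_M) \<and>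
     (\<forall>t\<in>S. ((\<lambda>s. Lp_norm p unit_M (\<lambda>x. (u s x - u t x) / (s - t) - v t x)) \<longlongrightarrow> 0)
               (at t within S))"

text \<open>
  \<open>u \<in> C\<^sup>1([0,T]; L\<^sup>p((0,1)))\<close> and \<open>\<partial>\<^sub>t u = \<L>\<^sup>W u\<close> in \<open>L\<^sup>p\<close> on \<open>[0,T]\<close>.
  The derivative \<open>v\<close> is unique as a path in \<open>L\<^sup>p\<close>.
\<close>

definition diffusion_solution ::
  "ennreal \<Rightarrow> real \<Rightarrow> (real \<Rightarrow> real \<Rightarrow> real) \<Rightarrow> (real \<Rightarrow> real \<Rightarrow> real) \<Rightarrow> bool" where
  "diffusion_solution p T W u \<longleftrightarrow>
     (\<exists>v. has_Lp_derivative_on p {0..T} u v \<and> Lp_continuous_on p {0..T} v \<and>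
          (\<forall>t\<in>{0..T}. AE x in unit_M. v t x = diffusion_op W (u t) x))"

end

(* By linearity w = u - u_n solves w' = L w + g, where L is the operator of W_n and
   g = (L^W - L^{W_n}) u satisfies |g| <= C = 2 ||u(0)|| ||W_n - W||, once the sup norm of u is
   known not to grow. For z = w - M - C t with M = ||w(0)|| put F(t) = \<integral> max 0 (z t).
   Since z' <= L z and 0 <= W_n <= K, the backward difference quotients of F at t are at most
   K F(t) + o(1); as F(0) = 0, a Gronwall argument gives F = 0, i.e. w(t) <= M + C t. The same
   argument applied to -w and to u itself supplies the rest. Convergence in L^p is only used
   through convergence in L^1. *)
theory Submission
  imports Defs "HOL-Probability.Probability_Measure"
begin

section \<open>A Gronwall inequality for backward difference quotients\<close>

lemma at_left_le_at_within_Icc: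
  fixes t :: real
  assumes "a < t" "t \<le> b"
  shows "at_left t \<le> at t within {a..b}"
proof -
  have "at t within {a..t} \<le> at t within {a..b}"
    using assms by (intro at_le) auto
  thus ?thesis using assms by (simp add: at_within_Icc_at_left)
qed

text \<open>\<open>F\<close> is compared with an exponential barrier \<open>b\<close> of rate
  \<open>K + 1\<close>. Where \<open>F\<close> first meets \<open>b\<close>, the barrier rises at
  rate \<open>(K + 1) * b\<close>, while the hypothesis with \<open>e = b / 2\<close> lets
  \<open>F\<close> rise from the left at rate at most \<open>(K + 1/2) * b\<close>. As
  \<open>F\<close> lies below \<open>b\<close> just before, this is impossible.\<close>

lemma dini_gronwall:
  fixes F :: "real \<Rightarrow> real"
  assumes cont: "continuous_on {0..T} F" and F0: "F 0 \<le> 0"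
    and dini: "\<And>t e. \<lbrakk>0 < t; t \<le> T; 0 < e\<rbrakk> \<Longrightarrow>
        \<forall>\<^sub>F s in at_left t. F t - F s \<le> (t - s) * (K * F t + e)"
    and K: "0 \<le> K" and t: "t \<in> {0..T}"
  shows "F t \<le> 0"
proof (rule field_le_epsilon)
  fix \<epsilon> :: real assume "0 < \<epsilon>"
  define L where "L = K + 1"
  \<comment> \<open>The factor is normalised so that the barrier takes the value \<epsilon> exactly
    at \<open>t\<close>.\<close>
  define d where "d = \<epsilon> * exp (- (L * t))"
  define b where "b s = d * exp (L * s)" for s
  have d: "d > 0" using \<open>0 < \<epsilon>\<close> by (simp add: d_def)
  have "F t \<le> b t"
  proof (rule ccontr)
    assume "\<not> F t \<le> b t"
    define H where "H s = F s - b s" for s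
    have Ht: "H t \<ge> 0" using \<open>\<not> F t \<le> b t\<close> by (simp add: H_def)
    have contH: "continuous_on {0..T} H"
      unfolding H_def b_def by (intro continuous_intros cont)
    have contH': "continuous_on {0..t} H"
      using contH by (rule continuous_on_subset) (use t in auto)
    define S where "S = {0..t} \<inter> H -` {0..}"
    have "closed S" unfolding S_def
      by (intro continuous_closed_preimage contH') auto
    have S: "t \<in> S" "bdd_below S" using Ht t by (auto simp: S_def intro!: bdd_belowI[of _ 0])
    \<comment> \<open>The first time at which \<open>F\<close> reaches the barrier: \<open>S\<close>
      is closed, so its infimum is attained, and \<open>H 0 < 0\<close> makes it positive.\<close>
    define \<tau> where "\<tau> = Inf S"
    have \<tau>S: "\<tau> \<in> S" unfolding \<tau>_def
      by (rule closed_contains_Inf) (use S \<open>closed S\<close> in auto)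
    have H0: "H 0 < 0" using F0 d by (simp add: H_def b_def)
    have \<tau>: "0 < \<tau>" "\<tau> \<le> t" "\<tau> \<le> T" using \<tau>S H0 t by (auto simp: S_def less_le)
    have neg: "H s < 0" if "0 \<le> s" "s < \<tau>" for s
    proof (rule ccontr)
      assume "\<not> H s < 0"
      hence "s \<in> S" using that \<tau> by (auto simp: S_def)
      hence "\<tau> \<le> s" unfolding \<tau>_def by (rule cInf_lower) (rule S(2))
      with that show False by simp
    qed
    have b\<tau>: "b \<tau> > 0" using d by (simp add: b_def)
    have ge: "H \<tau> \<ge> 0" using \<tau>S by (simp add: S_def)
    \<comment> \<open>Continuity from the left turns \<open>H < 0\<close> before \<tau> into contact
      at \<tau>, so that \<open>F \<tau>\<close> can be replaced by \<open>b \<tau>\<close> in the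
      slope bound.\<close>
    have "H \<tau> \<le> 0"
    proof -
      have "(H \<longlongrightarrow> H \<tau>) (at_left \<tau>)"
      proof -
        have "(H \<longlongrightarrow> H \<tau>) (at \<tau> within {0..T})"
          using contH \<tau> by (auto simp: continuous_on_def)
        moreover have "at_left \<tau> \<le> at \<tau> within {0..T}"
          using \<tau> by (intro at_left_le_at_within_Icc)
        ultimately show ?thesis by (rule tendsto_mono[rotated])
      qed
      moreover have "\<forall>\<^sub>F s in at_left \<tau>. H s \<le> 0"
        unfolding eventually_at_left[OF \<tau>(1)] using neg \<tau> by (intro exI[of _ 0]) (auto intro: less_imp_le)
      ultimately show ?thesis
        by (rule tendsto_upperbound) simp
    qed
    with ge have F\<tau>: "F \<tau> = b \<tau>" by (simp add: H_def)
    have "(b has_real_derivative L * b \<tau>) (at \<tau> within {..<\<tau>})"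
      unfolding b_def by (auto intro!: derivative_eq_intros)
    hence "((\<lambda>s. (b s - b \<tau>) / (s - \<tau>)) \<longlongrightarrow> L * b \<tau>) (at_left \<tau>)"
      by (simp add: has_field_derivative_iff)
    \<comment> \<open>The rate \<open>K + 1/2\<close> lies strictly between \<open>K\<close> and
      \<open>L\<close>: the left quotients of \<open>b\<close> eventually exceed it, and those of
      \<open>F\<close> eventually do not.\<close>
    moreover have "(K + 1/2) * b \<tau> < L * b \<tau>" using b\<tau> by (simp add: L_def)
    ultimately have "\<forall>\<^sub>F s in at_left \<tau>. (K + 1/2) * b \<tau> < (b s - b \<tau>) / (s - \<tau>)"
      by (rule order_tendstoD)
    moreover have "\<forall>\<^sub>F s in at_left \<tau>. F \<tau> - F s \<le> (\<tau> - s) * (K * F \<tau> + b \<tau> / 2)"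
      by (rule dini) (use \<tau> b\<tau> in auto)
    moreover have "\<forall>\<^sub>F s in at_left \<tau>. 0 < s \<and> s < \<tau>"
      unfolding eventually_at_left[OF \<tau>(1)] using \<tau> by (intro exI[of _ 0]) auto
    ultimately have "\<forall>\<^sub>F s in at_left \<tau>. False"
    proof eventually_elim
      case (elim s)
      have "(K + 1/2) * b \<tau> * (\<tau> - s) < b \<tau> - b s"
        using elim by (simp add: field_simps)
      moreover have "F s < b s" using neg[of s] elim by (simp add: H_def)
      ultimately show False using elim F\<tau> by (simp add: algebra_simps)
    qed
    thus False by (simp add: eventually_False)
  qed
  also have "b t = \<epsilon>" by (simp add: b_def d_def flip: exp_add)
  finally show "F t \<le> 0 + \<epsilon>" by simp
qed

section \<open>Lebesgue measure on the unit interval and sections over the unit square\<close>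

lemma prob_space_unit_M: "prob_space unit_M"
  by (rule prob_space.intro, rule finite_measure_lebesgue_on)
    (auto simp: prob_space_axioms_def emeasure_restrict_space)

lemma unit_square_sets_lebesgue [simp]:
  "{0<..<1} \<times> {0<..<1} \<in> sets (lebesgue :: (real \<times> real) measure)"
proof -
  have "{0<..<1} \<times> {0<..<1} \<in> sets (borel :: (real \<times> real) measure)"
    by (intro borel_open open_Times) auto
  thus ?thesis by simp
qed

text \<open>\<open>lebesgue\<close> on the plane is a completion and not a product measure.
  Completion does not change the meaning of almost everywhere, so Fubini for null sets can be
  applied to \<open>lborel\<close> and the result carried back.\<close>

lemma AE_square_M_sections:
  assumes "AE z in square_M. P z"
  shows "AE x in unit_M. AE y in unit_M. P (x, y)"
proof -
  have "AE z in (lebesgue :: (real \<times> real) measure). z \<in> {0<..<1} \<times> {0<..<1} \<longrightarrow> P z"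
    using assms by (subst (asm) AE_restrict_space_iff) auto
  hence "AE z in (lborel :: (real \<times> real) measure). z \<in> {0<..<1} \<times> {0<..<1} \<longrightarrow> P z"
    by (simp add: AE_completion_iff)
  hence "AE z in (lborel \<Otimes>\<^sub>M lborel). z \<in> {0<..<1::real} \<times> {0<..<1::real} \<longrightarrow> P z"
    unfolding lborel_prod .
  hence "AE x in lborel. AE y in lborel. (x, y) \<in> {0<..<1::real} \<times> {0<..<1::real} \<longrightarrow> P (x, y)"
    by (rule lborel_pair.AE_pair)
  hence "AE x in lebesgue. AE y in lebesgue. (x, y) \<in> {0<..<1::real} \<times> {0<..<1::real} \<longrightarrow> P (x, y)"
    by (simp add: AE_completion_iff)
  thus ?thesis
    by (auto simp: AE_restrict_space_iff elim!: eventually_mono)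
qed

text \<open>A Lebesgue measurable function may have nonmeasurable sections, but it equals a Borel
  function \<open>g\<close> almost everywhere. All sections of \<open>g\<close> are Borel, and
  almost all sections of \<open>f\<close> agree with them almost everywhere; completeness of
  \<open>lebesgue\<close> then makes those sections of \<open>f\<close> measurable.\<close>

lemma measurable_square_M_sections:
  fixes f :: "real \<times> real \<Rightarrow> real"
  assumes "f \<in> borel_measurable square_M"
  shows "AE x in unit_M. (\<lambda>y. f (x, y)) \<in> borel_measurable unit_M"
proof -
  let ?Q = "{0<..<1} \<times> {0<..<1} :: (real \<times> real) set"
  have "(\<lambda>z. indicator ?Q z *\<^sub>R f z) \<in> borel_measurable lebesgue"
    using assms by (subst (asm) borel_measurable_restrict_space_iff) (auto simp: mult.commute)
  then obtain g where g: "g \<in> borel_measurable lborel"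
    and eq: "AE z in lborel. indicator ?Q z *\<^sub>R f z = g z"
    using completion_ex_borel_measurable_real by blast
  have "AE z in square_M. f z = g z"
    using eq by (subst AE_restrict_space_iff) (auto simp: AE_completion_iff elim: eventually_mono)
  hence "AE x in unit_M. AE y in unit_M. f (x, y) = g (x, y)"
    by (rule AE_square_M_sections)
  thus ?thesis
  proof eventually_elim
    case (elim x)
    have "(\<lambda>y. g (x, y)) \<in> borel_measurable lborel"
      using g by simp
    hence "(\<lambda>y. g (x, y)) \<in> borel_measurable lebesgue"
      by (rule measurable_completion)
    hence "(\<lambda>y. indicator {0<..<1} y *\<^sub>R g (x, y)) \<in> borel_measurable lebesgue"
      by (intro borel_measurable_scaleR borel_measurable_indicator) auto
    moreover have "AE y in lebesgue. indicator {0<..<1} y *\<^sub>R g (x, y)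
        = indicator {0<..<1} y *\<^sub>R f (x, y)"
      using elim by (subst (asm) AE_restrict_space_iff)
        (auto elim!: eventually_mono simp: indicator_def)
    ultimately have "(\<lambda>y. indicator {0<..<1} y *\<^sub>R f (x, y)) \<in> borel_measurable lebesgue"
      by (rule borel_measurable_AE)
    thus ?case
      by (subst borel_measurable_restrict_space_iff) (auto simp: mult.commute)
  qed
qed


interpretation unit_M: prob_space unit_M
  by (rule prob_space_unit_M)

section \<open>Essential bounds, and passage from L^p to L^1\<close>

lemma Lp_infinity_AE_le:
  assumes "f \<in> Lp \<infinity> M"
  shows "AE x in M. \<bar>f x\<bar> \<le> enn2real (Lp_norm \<infinity> M f)"
proof -
  have "Lp_norm \<infinity> M f < \<infinity>" using assms by (simp add: Lp_def)
  hence "ennreal (enn2real (Lp_norm \<infinity> M f)) = Lp_norm \<infinity> M f" by (simp add: less_top)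
  moreover have "AE x in M. ennreal \<bar>f x\<bar> \<le> Lp_norm \<infinity> M f"
    unfolding Lp_norm_def by (simp add: esssup_AE)
  ultimately have "AE x in M. ennreal \<bar>f x\<bar> \<le> ennreal (enn2real (Lp_norm \<infinity> M f))" by simp
  thus ?thesis by (auto elim!: eventually_mono)
qed

lemma Lp_norm_infinity_le:
  assumes "f \<in> borel_measurable M" "AE x in M. \<bar>f x\<bar> \<le> c"
  shows "Lp_norm \<infinity> M f \<le> ennreal c"
  using assms unfolding Lp_norm_def
  by (auto elim!: eventually_mono intro!: ennreal_leI)

text \<open>An elementary replacement for Jensen's inequality. The pointwise bound \<open>*\<close>
  integrates to c + c^(1-q) * c^q = 2 * c; the lost factor 2 is harmless for integrability and for
  limits equal to 0.\<close>

lemma (in prob_space) nn_integral_abs_le_Lp_norm: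
  assumes p: "1 \<le> p" and f [measurable]: "f \<in> borel_measurable M"
    and c: "0 < c" and le: "Lp_norm p M f \<le> ennreal c"
  shows "(\<integral>\<^sup>+x. ennreal \<bar>f x\<bar> \<partial>M) \<le> ennreal (2 * c)"
proof (cases "p = \<infinity>")
  case True
  have "AE x in M. ennreal \<bar>f x\<bar> \<le> esssup M (\<lambda>x. ennreal \<bar>f x\<bar>)" by (rule esssup_AE)
  hence "AE x in M. ennreal \<bar>f x\<bar> \<le> ennreal (2 * c)"
  proof eventually_elim
    case (elim x)
    also have "esssup M (\<lambda>x. ennreal \<bar>f x\<bar>) \<le> ennreal c"
      using le True by (simp add: Lp_norm_def)
    also have "\<dots> \<le> ennreal (2 * c)" using c by (intro ennreal_leI) simp
    finally show ?case .
  qed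
  hence "(\<integral>\<^sup>+x. ennreal \<bar>f x\<bar> \<partial>M) \<le> (\<integral>\<^sup>+x. ennreal (2 * c) \<partial>M)" by (rule nn_integral_mono_AE)
  thus ?thesis by (simp add: emeasure_space_1)
next
  case False
  define q where "q = enn2real p"
  have "p = ennreal q" using False by (simp add: q_def less_top)
  with p have q: "1 \<le> q" by (simp add: ennreal_ge_1)
  define I where "I = (\<integral>\<^sup>+ x. ennreal (\<bar>f x\<bar> powr q) \<partial>M)"
  have norm: "Lp_norm p M f = (if I = \<infinity> then \<infinity> else ennreal (enn2real I powr (1 / q)))"
    using False by (simp add: Lp_norm_def I_def q_def)
  have I: "I \<noteq> \<infinity>" using norm le by (auto simp: top_unique split: if_splits)
  have "enn2real I powr (1 / q) \<le> c" using norm le I c by simp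
  hence "(enn2real I powr (1 / q)) powr q \<le> c powr q" using q by (intro powr_mono2) auto
  hence "enn2real I \<le> c powr q" using q by (simp add: powr_powr)
  hence I_le: "I \<le> ennreal (c powr q)"
    using I by (metis ennreal_enn2real ennreal_leI infinity_ennreal_def less_top)
  \<comment> \<open>The first summand covers the points with \<open>\<bar>f x\<bar> \<le> c\<close>.
    Elsewhere the exponent \<open>1 - q\<close> is nonpositive, so
    \<open>\<bar>f x\<bar> powr (1 - q)\<close> is at most \<open>c powr (1 - q)\<close>.\<close>
  have *: "\<bar>f x\<bar> \<le> c + c powr (1 - q) * \<bar>f x\<bar> powr q" for x
  proof (cases "\<bar>f x\<bar> \<le> c")
    case False
    have "\<bar>f x\<bar> = \<bar>f x\<bar> powr (1 - q) * \<bar>f x\<bar> powr q"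
      using False c by (simp flip: powr_add)
    also have "\<dots> \<le> c powr (1 - q) * \<bar>f x\<bar> powr q"
      using False c q by (intro mult_right_mono powr_mono2') auto
    finally show ?thesis using c by linarith
  qed (simp add: add_increasing2)
  have "(\<integral>\<^sup>+x. ennreal \<bar>f x\<bar> \<partial>M)
      \<le> (\<integral>\<^sup>+x. ennreal c + ennreal (c powr (1 - q)) * ennreal (\<bar>f x\<bar> powr q) \<partial>M)"
    using c by (intro nn_integral_mono)
      (auto simp: * ennreal_leI simp flip: ennreal_plus ennreal_mult)
  also have "\<dots> = ennreal c + ennreal (c powr (1 - q)) * I"
    by (simp add: nn_integral_add nn_integral_cmult I_def emeasure_space_1)
  also have "\<dots> \<le> ennreal c + ennreal (c powr (1 - q)) * ennreal (c powr q)"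
    by (intro add_left_mono mult_left_mono I_le) auto
  also have "\<dots> = ennreal (2 * c)"
    using c by (simp flip: ennreal_plus ennreal_mult powr_add)
  finally show ?thesis .
qed

lemma (in prob_space) integrable_Lp:
  assumes "1 \<le> p" and "f \<in> Lp p M"
  shows "integrable M f"
proof -
  have f: "f \<in> borel_measurable M" "Lp_norm p M f < \<infinity>" using assms(2) by (auto simp: Lp_def)
  \<comment> \<open>Adding 1 keeps \<open>c\<close> positive even when the norm is 0.\<close>
  define c where "c = enn2real (Lp_norm p M f) + 1"
  have "c > 0" by (simp add: c_def add_nonneg_pos)
  moreover have "Lp_norm p M f \<le> ennreal c"
    using f(2) by (simp add: c_def less_top[symmetric] ennreal_le_iff2 flip: ennreal_enn2real_if)
  ultimately have "(\<integral>\<^sup>+x. ennreal \<bar>f x\<bar> \<partial>M) \<le> ennreal (2 * c)"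
    using assms(1) f(1) by (intro nn_integral_abs_le_Lp_norm)
  thus ?thesis
    using f(1) by (auto simp: integrable_iff_bounded less_top[symmetric] top_unique)
qed

lemma (in prob_space) tendsto_L1_if_tendsto_Lp:
  assumes p: "1 \<le> p" and meas: "\<forall>\<^sub>F s in F. f s \<in> borel_measurable M"
    and lim: "((\<lambda>s. Lp_norm p M (f s)) \<longlongrightarrow> 0) F"
  shows "((\<lambda>s. LINT x|M. \<bar>f s x\<bar>) \<longlongrightarrow> 0) F"
proof (rule tendstoI)
  fix e :: real assume "0 < e"
  \<comment> \<open>With the factor 2 of the norm comparison, e/4 leads to e/2, which is strictly
    below e.\<close>
  have "\<forall>\<^sub>F s in F. Lp_norm p M (f s) < ennreal (e / 4)"
    using lim \<open>0 < e\<close> by (intro order_tendstoD) auto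
  with meas show "\<forall>\<^sub>F s in F. dist (LINT x|M. \<bar>f s x\<bar>) 0 < e"
  proof eventually_elim
    case (elim s)
    have "(\<integral>\<^sup>+x. ennreal \<bar>f s x\<bar> \<partial>M) \<le> ennreal (2 * (e / 4))"
      using p elim \<open>0 < e\<close> by (intro nn_integral_abs_le_Lp_norm) auto
    hence "enn2real (\<integral>\<^sup>+x. ennreal \<bar>f s x\<bar> \<partial>M) \<le> 2 * (e / 4)"
      using \<open>0 < e\<close> by (intro enn2real_leI) auto
    moreover have "(LINT x|M. \<bar>f s x\<bar>) = enn2real (\<integral>\<^sup>+x. ennreal \<bar>f s x\<bar> \<partial>M)"
      using elim by (intro integral_eq_nn_integral) auto
    ultimately show ?case using \<open>0 < e\<close> by (simp add: dist_real_def)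
  qed
qed


section \<open>A comparison principle in L^1\<close>

lemma diffusion_op_le_positive_part:
  assumes "AE y in unit_M. 0 \<le> W x y \<and> W x y \<le> K" and "0 \<le> K"
    and int: "integrable unit_M (\<lambda>y. max 0 (w y - c))" and "c < w x"
  shows "diffusion_op W w x \<le> K * (LINT y|unit_M. max 0 (w y - c))"
proof -
  have "diffusion_op W w x \<le> (LINT y|unit_M. K * max 0 (w y - c))"
    unfolding diffusion_op_def
  \<comment> \<open>This form of monotonicity asks for integrability of the nonnegative majorant
    only. If the left integrand is not integrable, its integral is 0 by convention and the
    inequality still holds.\<close>
  proof (rule integral_mono_AE')
    show "AE y in unit_M. W x y * (w y - w x) \<le> K * max 0 (w y - c)"
      using assms(1)
    proof eventually_elim
      case (elim y)
      \<comment> \<open>Since \<open>c < w x\<close>, replacing \<open>w x\<close> by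
        \<open>c\<close> increases the difference, and the weight is nonnegative.\<close>
      have "W x y * (w y - w x) \<le> W x y * max 0 (w y - c)"
        using elim \<open>c < w x\<close> by (intro mult_left_mono) auto
      also have "\<dots> \<le> K * max 0 (w y - c)" using elim by (intro mult_right_mono) auto
      finally show ?case .
    qed
  qed (use int \<open>0 \<le> K\<close> in auto)
  thus ?thesis using int by simp
qed

text \<open>The operator annihilates constants in x and \<open>C\<close> bounds the source from
  above, so the level \<open>M + C * t\<close> acts as a supersolution. The excess over this level
  is measured by its integral \<open>F\<close>.\<close>

lemma diffusion_upper_bound:
  assumes K: "0 \<le> K" and W: "AE x in unit_M. AE y in unit_M. 0 \<le> W x y \<and> W x y \<le> K"
    and w [simp]: "\<And>t. t \<in> {0..T} \<Longrightarrow> integrable unit_M (w t)"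
    and v [simp]: "\<And>t. t \<in> {0..T} \<Longrightarrow> integrable unit_M (v t)"
    and deriv: "\<And>t. t \<in> {0..T} \<Longrightarrow>
        ((\<lambda>s. LINT x|unit_M. \<bar>(w s x - w t x) / (s - t) - v t x\<bar>) \<longlongrightarrow> 0) (at t within {0..T})"
    and sub: "\<And>t. t \<in> {0..T} \<Longrightarrow> AE x in unit_M. v t x \<le> diffusion_op W (w t) x + C"
    and init: "AE x in unit_M. w 0 x \<le> M"
    and t: "t \<in> {0..T}"
  shows "AE x in unit_M. w t x \<le> M + C * t"
proof -
  define z where "z s x = w s x - (M + C * s)" for s x
  define F where "F s = (LINT x|unit_M. max 0 (z s x))" for s
  \<comment> \<open>\<open>R\<close> is the error of the difference quotient as an approximation of
    the derivative, and \<open>E\<close> is its L^1 norm, which tends to 0.\<close>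
  define R where "R s t x = (w s x - w t x) / (s - t) - v t x" for s t x
  define E where "E s t = (LINT x|unit_M. \<bar>R s t x\<bar>)" for s t
  have z_int [simp]: "integrable unit_M (\<lambda>x. max 0 (z s x))" if "s \<in> {0..T}" for s
    unfolding z_def using that by (intro integrable_max Bochner_Integration.integrable_diff) auto
  have R_int [simp]: "integrable unit_M (R s t)" if "s \<in> {0..T}" "t \<in> {0..T}" for s t
    unfolding R_def using that by (intro Bochner_Integration.integrable_diff integrable_divide_zero) auto
  have E_lim: "((\<lambda>s. E s t) \<longlongrightarrow> 0) (at t within {0..T})" if "t \<in> {0..T}" for t
    using deriv[OF that] by (simp add: E_def R_def)
  have z_eq: "z s x = z t x + (s - t) * (R s t x + v t x - C)" if "s \<noteq> t" for s t x
    using that by (simp add: z_def R_def field_simps)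
  have F_nonneg: "0 \<le> F s" for s unfolding F_def by (intro integral_nonneg_AE) auto

  \<comment> \<open>Going backward from \<open>t\<close> avoids a chain rule for the positive part:
    the sign of \<open>z\<close> at \<open>t\<close> alone separates the cases. Where it is
    positive, the derivative is at most \<open>K * F t + C\<close>; elsewhere the left side of the
    pointwise inequality is at most 0.\<close>
  have F_step: "F t - F s \<le> (t - s) * (K * F t + E s t)" if st: "0 \<le> s" "s < t" "t \<le> T" for s t
  proof -
    have st': "s \<in> {0..T}" "t \<in> {0..T}" using st by auto
    have "AE x in unit_M. max 0 (z t x) - (t - s) * (K * F t + \<bar>R s t x\<bar>) \<le> max 0 (z s x)"
      using W sub[OF st'(2)]
    proof eventually_elim
      case (elim x)
      show ?case
      proof (cases "0 < z t x")
        case True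
        \<comment> \<open>Here the level \<open>c\<close> is \<open>M + C * t\<close>, and
          \<open>0 < z t x\<close> says precisely that \<open>w t x\<close> exceeds it.\<close>
        have "diffusion_op W (w t) x \<le> K * F t"
          unfolding F_def z_def
          by (rule diffusion_op_le_positive_part[where W = W and x = x and K = K])
            (use elim(1) K True z_int[OF st'(2)] in \<open>auto simp: z_def\<close>)
        hence "R s t x + v t x - C \<le> K * F t + \<bar>R s t x\<bar>" using elim(2) by linarith
        hence "(t - s) * (R s t x + v t x - C) \<le> (t - s) * (K * F t + \<bar>R s t x\<bar>)"
          using st by (intro mult_left_mono) auto
        moreover have "z s x = z t x - (t - s) * (R s t x + v t x - C)"
          using z_eq[of s t x] st by (simp add: algebra_simps)
        ultimately show ?thesis using True by simp
      next
        case False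
        have "0 \<le> (t - s) * (K * F t + \<bar>R s t x\<bar>)"
          using st K F_nonneg by (intro mult_nonneg_nonneg add_nonneg_nonneg) auto
        thus ?thesis using False by simp
      qed
    qed
    hence "(LINT x|unit_M. max 0 (z t x) - (t - s) * (K * F t + \<bar>R s t x\<bar>))
        \<le> (LINT x|unit_M. max 0 (z s x))"
      using st' by (intro integral_mono_AE) auto
    also have "(LINT x|unit_M. max 0 (z t x) - (t - s) * (K * F t + \<bar>R s t x\<bar>))
        = F t - (t - s) * (K * F t + E s t)"
      using st' unit_M.prob_space by (simp add: F_def E_def)
    finally show ?thesis by (simp add: F_def)
  qed

  have F_cont: "continuous_on {0..T} F"
    unfolding continuous_on_def
  proof
    fix t assume t: "t \<in> {0..T}"
    let ?V = "LINT x|unit_M. \<bar>v t x\<bar>"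
    \<comment> \<open>The positive part is 1-Lipschitz, so \<open>z_eq\<close> controls the
      increment of \<open>F\<close>. The point \<open>s = t\<close>, where the quotient in
      \<open>R\<close> divides by 0, is excluded here and is invisible to the limit.\<close>
    have bound: "norm (F s - F t) \<le> \<bar>s - t\<bar> * (E s t + ?V + \<bar>C\<bar>)" if s: "s \<in> {0..T}" "s \<noteq> t" for s
    proof -
      have "norm (F s - F t) = norm (LINT x|unit_M. max 0 (z s x) - max 0 (z t x))"
        using s t by (simp add: F_def)
      also have "\<dots> \<le> (LINT x|unit_M. norm (max 0 (z s x) - max 0 (z t x)))"
        by (rule integral_norm_bound)
      also have "\<dots> \<le> (LINT x|unit_M. \<bar>s - t\<bar> * (\<bar>R s t x\<bar> + \<bar>v t x\<bar> + \<bar>C\<bar>))"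
      proof (rule integral_mono)
        fix x
        have "norm (max 0 (z s x) - max 0 (z t x)) \<le> \<bar>z s x - z t x\<bar>" by auto
        also have "\<dots> = \<bar>s - t\<bar> * \<bar>R s t x + v t x - C\<bar>"
          using z_eq[of s t x] s by (simp add: abs_mult)
        also have "\<dots> \<le> \<bar>s - t\<bar> * (\<bar>R s t x\<bar> + \<bar>v t x\<bar> + \<bar>C\<bar>)"
          by (intro mult_left_mono) auto
        finally show "norm (max 0 (z s x) - max 0 (z t x)) \<le> \<dots>" .
      qed (use s t in auto)
      also have "\<dots> = \<bar>s - t\<bar> * (E s t + ?V + \<bar>C\<bar>)"
        using s t unit_M.prob_space by (simp add: E_def)
      finally show ?thesis .
    qed
    have "((\<lambda>s. F s - F t) \<longlongrightarrow> 0) (at t within {0..T})"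
    proof (rule Lim_null_comparison)
      show "\<forall>\<^sub>F s in at t within {0..T}. norm (F s - F t) \<le> \<bar>s - t\<bar> * (E s t + ?V + \<bar>C\<bar>)"
        using bound by (auto simp: eventually_at_filter)
      have "((\<lambda>s. \<bar>s - t\<bar> * (E s t + ?V + \<bar>C\<bar>)) \<longlongrightarrow> \<bar>t - t\<bar> * (0 + ?V + \<bar>C\<bar>)) (at t within {0..T})"
        by (intro tendsto_intros E_lim t)
      thus "((\<lambda>s. \<bar>s - t\<bar> * (E s t + ?V + \<bar>C\<bar>)) \<longlongrightarrow> 0) (at t within {0..T})" by simp
    qed
    thus "(F \<longlongrightarrow> F t) (at t within {0..T})" by (simp add: LIM_zero_iff)
  qed

  have "w 0 \<in> borel_measurable unit_M" using w[of 0] t by (auto simp del: w)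
  \<comment> \<open>At time 0 the level is \<open>M\<close>, so the initial bound makes the positive
    part vanish almost everywhere.\<close>
  hence "F 0 = (LINT x|unit_M. 0)"
    unfolding F_def using init
    by (intro integral_cong_AE) (auto simp: z_def elim!: eventually_mono)
  hence "F 0 \<le> 0" by simp
  with F_cont have "F t \<le> 0"
  proof (rule dini_gronwall)
    fix r e :: real assume r: "0 < r" "r \<le> T" and "0 < e"
    have "\<forall>\<^sub>F s in at_left r. E s r < e"
      using tendsto_mono[OF at_left_le_at_within_Icc[OF r] E_lim] r \<open>0 < e\<close>
      by (intro order_tendstoD) auto
    moreover have "\<forall>\<^sub>F s in at_left r. 0 < s \<and> s < r"
      unfolding eventually_at_left[OF r(1)] using r by (intro exI[of _ 0]) auto
    ultimately show "\<forall>\<^sub>F s in at_left r. F r - F s \<le> (r - s) * (K * F r + e)"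
    proof eventually_elim
      case (elim s)
      have "F r - F s \<le> (r - s) * (K * F r + E s r)" using elim r by (intro F_step) auto
      also have "\<dots> \<le> (r - s) * (K * F r + e)" using elim by (intro mult_left_mono) auto
      finally show ?case .
    qed
  qed (use K t in auto)
  with F_nonneg have "F t = 0" by (simp add: order_antisym)
  hence "AE x in unit_M. max 0 (z t x) = 0"
    unfolding F_def using t by (subst (asm) integral_nonneg_eq_0_iff_AE) auto
  thus ?thesis by (auto simp: z_def max_def elim!: eventually_mono split: if_splits)
qed

lemma diffusion_op_uminus: "diffusion_op W (\<lambda>x. - f x) x = - diffusion_op W f x"
proof -
  have "W x y * (- f y - - f x) = - (W x y * (f y - f x))" for y by (simp add: algebra_simps)
  thus ?thesis by (simp only: diffusion_op_def integral_minus)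
qed

lemma diffusion_abs_bound:
  assumes K: "0 \<le> K" and W: "AE x in unit_M. AE y in unit_M. 0 \<le> W x y \<and> W x y \<le> K"
    and w: "\<And>t. t \<in> {0..T} \<Longrightarrow> integrable unit_M (w t)"
    and v: "\<And>t. t \<in> {0..T} \<Longrightarrow> integrable unit_M (v t)"
    and deriv: "\<And>t. t \<in> {0..T} \<Longrightarrow>
        ((\<lambda>s. LINT x|unit_M. \<bar>(w s x - w t x) / (s - t) - v t x\<bar>) \<longlongrightarrow> 0) (at t within {0..T})"
    and eqn: "\<And>t. t \<in> {0..T} \<Longrightarrow> AE x in unit_M. \<bar>v t x - diffusion_op W (w t) x\<bar> \<le> C"
    and init: "AE x in unit_M. \<bar>w 0 x\<bar> \<le> M"
    and t: "t \<in> {0..T}"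
  shows "AE x in unit_M. \<bar>w t x\<bar> \<le> M + C * t"
proof -
  have "AE x in unit_M. w t x \<le> M + C * t"
  proof (rule diffusion_upper_bound[OF K W w v deriv _ _ t])
    fix t assume "t \<in> {0..T}"
    show "AE x in unit_M. v t x \<le> diffusion_op W (w t) x + C"
      using eqn[OF \<open>t \<in> {0..T}\<close>] by (auto elim!: eventually_mono)
  qed (use init in \<open>auto elim!: eventually_mono\<close>)
  moreover have "AE x in unit_M. - w t x \<le> M + C * t"
  proof (rule diffusion_upper_bound[OF K W _ _ _ _ _ t, where w = "\<lambda>t x. - w t x" and v = "\<lambda>t x. - v t x"])
    fix t assume "t \<in> {0..T}"
    have "\<bar>(- w s x - - w t x) / (s - t) - - v t x\<bar> = \<bar>(w s x - w t x) / (s - t) - v t x\<bar>" for s x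
      by (subst abs_minus_cancel[symmetric]) (simp add: minus_divide_left)
    with deriv[OF \<open>t \<in> {0..T}\<close>]
    show "((\<lambda>s. LINT x|unit_M. \<bar>(- w s x - - w t x) / (s - t) - - v t x\<bar>) \<longlongrightarrow> 0) (at t within {0..T})"
      by (simp only:)
  next
    fix t assume "t \<in> {0..T}"
    show "AE x in unit_M. - v t x \<le> diffusion_op W (\<lambda>x. - w t x) x + C"
      using eqn[OF \<open>t \<in> {0..T}\<close>] unfolding diffusion_op_uminus
      by (auto elim!: eventually_mono)
  qed (use w v init in \<open>auto elim!: eventually_mono\<close>)
  ultimately show ?thesis by eventually_elim auto
qed

section \<open>Perturbation of the kernel, and solutions viewed in L^1\<close>

lemma diffusion_op_diff_bound:
  assumes W1: "(\<lambda>y. W1 x y) \<in> borel_measurable unit_M" "AE y in unit_M. \<bar>W1 x y\<bar> \<le> K1"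
    and W2: "(\<lambda>y. W2 x y) \<in> borel_measurable unit_M" "AE y in unit_M. \<bar>W2 x y\<bar> \<le> K2"
    and f: "integrable unit_M f" and g: "integrable unit_M g"
    and \<delta>: "AE y in unit_M. \<bar>W1 x y - W2 x y\<bar> \<le> \<delta>"
    and U: "AE y in unit_M. \<bar>f y\<bar> \<le> U" "\<bar>f x\<bar> \<le> U"
  shows "\<bar>diffusion_op W1 f x - diffusion_op W2 g x - diffusion_op W2 (\<lambda>y. f y - g y) x\<bar> \<le> 2 * U * \<delta>"
proof -
  \<comment> \<open>Bochner integrals may be combined only for integrable integrands; an essentially
    bounded kernel section guarantees this for all three operators.\<close>
  have int: "integrable unit_M (\<lambda>y. V y * (h y - h x))"
    if V: "V \<in> borel_measurable unit_M" "AE y in unit_M. \<bar>V y\<bar> \<le> K"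
      and h: "integrable unit_M h" for V h and K :: real
  proof (rule Bochner_Integration.integrable_bound)
    show "integrable unit_M (\<lambda>y. K * (\<bar>h y\<bar> + \<bar>h x\<bar>))" using h by auto
    show "AE y in unit_M. norm (V y * (h y - h x)) \<le> norm (K * (\<bar>h y\<bar> + \<bar>h x\<bar>))"
      using V(2)
    proof eventually_elim
      case (elim y)
      have "\<bar>V y\<bar> * \<bar>h y - h x\<bar> \<le> K * (\<bar>h y\<bar> + \<bar>h x\<bar>)"
        using elim by (intro mult_mono) auto
      thus ?case using elim by (simp add: abs_mult)
    qed
  qed (use V h in auto)
  \<comment> \<open>All terms in \<open>g\<close> cancel, leaving the difference of the kernels
    applied to \<open>f\<close> alone. The increment of \<open>f\<close> is at most
    \<open>2 * U\<close>, which is the source of the factor 2 in the final estimate.\<close>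
  let ?D = "\<lambda>y. (W1 x y - W2 x y) * (f y - f x)"
  have "diffusion_op W1 f x - diffusion_op W2 g x - diffusion_op W2 (\<lambda>y. f y - g y) x
      = (LINT y|unit_M. W1 x y * (f y - f x) - W2 x y * (g y - g x)
          - W2 x y * ((f y - g y) - (f x - g x)))"
    unfolding diffusion_op_def
    using int[OF W1 f] int[OF W2 g] int[OF W2 Bochner_Integration.integrable_diff[OF f g]] by simp
  also have "\<dots> = (LINT y|unit_M. ?D y)" by (simp add: algebra_simps)
  finally have eq: "diffusion_op W1 f x - diffusion_op W2 g x
      - diffusion_op W2 (\<lambda>y. f y - g y) x = (LINT y|unit_M. ?D y)" .
  have "AE y in unit_M. \<bar>?D y\<bar> \<le> \<delta> * (2 * U)"
    using \<delta> U(1)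
  proof eventually_elim
    case (elim y)
    show ?case using elim U(2) by (auto simp: abs_mult intro!: mult_mono)
  qed
  \<comment> \<open>The majorant must be nonnegative for \<open>integral_mono_AE'\<close>. Its sign
    follows from the bound itself: on a probability space a property that holds almost everywhere
    holds at some point.\<close>
  moreover from eventually_happens'[OF unit_M.ae_filter_bot this] have "0 \<le> \<delta> * (2 * U)"
    by (meson abs_ge_zero order_trans)
  ultimately have "(LINT y|unit_M. \<bar>?D y\<bar>) \<le> (LINT y|unit_M. \<delta> * (2 * U))"
    by (intro integral_mono_AE') auto
  hence "(LINT y|unit_M. \<bar>?D y\<bar>) \<le> 2 * U * \<delta>"
    using unit_M.prob_space by (simp add: mult_ac)
  thus ?thesis unfolding eq by (rule order_trans[OF integral_abs_bound])
qed

text \<open>Covers finite and infinite exponents alike, so that the graphon solution and the graph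
  solution can be subtracted in the common space L^1.\<close>

lemma diffusion_solution_L1:
  assumes p: "1 \<le> p" and sol: "diffusion_solution p T W u"
  obtains v where "\<And>t. t \<in> {0..T} \<Longrightarrow> integrable unit_M (u t)"
    and "\<And>t. t \<in> {0..T} \<Longrightarrow> integrable unit_M (v t)"
    and "\<And>t. t \<in> {0..T} \<Longrightarrow>
      ((\<lambda>s. LINT x|unit_M. \<bar>(u s x - u t x) / (s - t) - v t x\<bar>) \<longlongrightarrow> 0) (at t within {0..T})"
    and "\<And>t. t \<in> {0..T} \<Longrightarrow> AE x in unit_M. v t x = diffusion_op W (u t) x"
proof -
  obtain v where der: "has_Lp_derivative_on p {0..T} u v"
    and eqn: "\<forall>t\<in>{0..T}. AE x in unit_M. v t x = diffusion_op W (u t) x"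
    using sol unfolding diffusion_solution_def by blast
  have Lp: "u t \<in> Lp p unit_M" "v t \<in> Lp p unit_M" if "t \<in> {0..T}" for t
    using der that by (auto simp: has_Lp_derivative_on_def)
  have meas: "u t \<in> borel_measurable unit_M" "v t \<in> borel_measurable unit_M" if "t \<in> {0..T}" for t
    using Lp[OF that] by (auto simp: Lp_def)
  show thesis
  proof (rule that)
    fix t assume t: "t \<in> {0..T}"
    show "((\<lambda>s. LINT x|unit_M. \<bar>(u s x - u t x) / (s - t) - v t x\<bar>) \<longlongrightarrow> 0) (at t within {0..T})"
    proof (rule unit_M.tendsto_L1_if_tendsto_Lp[OF p])
      show "\<forall>\<^sub>F s in at t within {0..T}. (\<lambda>x. (u s x - u t x) / (s - t) - v t x) \<in> borel_measurable unit_M"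
        using meas t by (auto simp: eventually_at_filter intro!: always_eventually
            borel_measurable_diff borel_measurable_divide)
    qed (use der t in \<open>simp add: has_Lp_derivative_on_def\<close>)
  qed (use unit_M.integrable_Lp[OF p] Lp eqn in auto)
qed

section \<open>Differences and sections of essentially bounded kernels\<close>

lemma Lp_infinity_diff:
  assumes "f \<in> Lp \<infinity> M" "g \<in> Lp \<infinity> M"
  shows "(\<lambda>x. f x - g x) \<in> Lp \<infinity> M"
proof -
  have meas: "(\<lambda>x. f x - g x) \<in> borel_measurable M" using assms by (auto simp: Lp_def)
  have "AE x in M. \<bar>f x - g x\<bar> \<le> enn2real (Lp_norm \<infinity> M f) + enn2real (Lp_norm \<infinity> M g)"
    using assms[THEN Lp_infinity_AE_le] by eventually_elim linarith
  from Lp_norm_infinity_le[OF meas this] show ?thesis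
    using meas by (auto simp: Lp_def less_top[symmetric] top_unique)
qed

lemma Lp_infinity_sections:
  assumes "(\<lambda>(x, y). V x y) \<in> Lp \<infinity> square_M"
  shows "AE x in unit_M. V x \<in> borel_measurable unit_M"
    and "AE x in unit_M. AE y in unit_M. \<bar>V x y\<bar> \<le> enn2real (Lp_norm \<infinity> square_M (\<lambda>(x, y). V x y))"
proof -
  show "AE x in unit_M. V x \<in> borel_measurable unit_M"
    using measurable_square_M_sections[of "\<lambda>(x, y). V x y"] assms by (simp add: Lp_def)
  show "AE x in unit_M. AE y in unit_M. \<bar>V x y\<bar> \<le> enn2real (Lp_norm \<infinity> square_M (\<lambda>(x, y). V x y))"
    using AE_square_M_sections[OF Lp_infinity_AE_le[OF assms]] by simp
qed

lemma graphon_sections: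
  assumes "graphon W" "(\<lambda>(x, y). W x y) \<in> Lp \<infinity> square_M"
  shows "AE x in unit_M. AE y in unit_M.
    0 \<le> W x y \<and> W x y \<le> enn2real (Lp_norm \<infinity> square_M (\<lambda>(x, y). W x y))"
proof -
  have "AE x in unit_M. x \<in> {0<..<1}" by (rule AE_I2) simp
  with Lp_infinity_sections(2)[OF assms(2)] show ?thesis
  proof eventually_elim
    case (elim x)
    have "AE y in unit_M. y \<in> {0<..<1}" by (rule AE_I2) simp
    with elim(1) show ?case
    proof eventually_elim
      case (elim y)
      thus ?case using assms(1) \<open>x \<in> {0<..<1}\<close> by (auto simp: graphon_def)
    qed
  qed
qed

section \<open>The stability estimate for two kernels\<close>

lemma diffusion_stability:
  assumes p: "1 \<le> p"
    and W1: "graphon W1" "(\<lambda>(x, y). W1 x y) \<in> Lp \<infinity> square_M"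
    and W2: "graphon W2" "(\<lambda>(x, y). W2 x y) \<in> Lp \<infinity> square_M"
    and sol1: "diffusion_solution \<infinity> T W1 u1" and sol2: "diffusion_solution p T W2 u2"
    and t: "t \<in> {0..T}"
  shows "Lp_norm \<infinity> unit_M (\<lambda>x. u1 t x - u2 t x)
    \<le> Lp_norm \<infinity> unit_M (\<lambda>x. u1 0 x - u2 0 x)
      + ennreal (2 * t) * Lp_norm \<infinity> unit_M (u1 0)
        * Lp_norm \<infinity> square_M (\<lambda>(x, y). W2 x y - W1 x y)"
\<comment> \<open>If the initial distance is infinite, so is the right side. Otherwise every norm on
  the right is finite and passing to real numbers by \<open>enn2real\<close> loses nothing.\<close>
proof (cases "Lp_norm \<infinity> unit_M (\<lambda>x. u1 0 x - u2 0 x) = \<infinity>")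
  case False
  define K1 where "K1 = enn2real (Lp_norm \<infinity> square_M (\<lambda>(x, y). W1 x y))"
  define K2 where "K2 = enn2real (Lp_norm \<infinity> square_M (\<lambda>(x, y). W2 x y))"
  define U where "U = enn2real (Lp_norm \<infinity> unit_M (u1 0))"
  define \<delta> where "\<delta> = enn2real (Lp_norm \<infinity> square_M (\<lambda>(x, y). W2 x y - W1 x y))"
  define M where "M = enn2real (Lp_norm \<infinity> unit_M (\<lambda>x. u1 0 x - u2 0 x))"
  obtain v1 where sol1':
    "\<And>t. t \<in> {0..T} \<Longrightarrow> integrable unit_M (u1 t)"
    "\<And>t. t \<in> {0..T} \<Longrightarrow> integrable unit_M (v1 t)"
    "\<And>t. t \<in> {0..T} \<Longrightarrow>
      ((\<lambda>s. LINT x|unit_M. \<bar>(u1 s x - u1 t x) / (s - t) - v1 t x\<bar>) \<longlongrightarrow> 0) (at t within {0..T})"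
    "\<And>t. t \<in> {0..T} \<Longrightarrow> AE x in unit_M. v1 t x = diffusion_op W1 (u1 t) x"
    by (rule diffusion_solution_L1[OF _ sol1]) auto
  obtain v2 where sol2':
    "\<And>t. t \<in> {0..T} \<Longrightarrow> integrable unit_M (u2 t)"
    "\<And>t. t \<in> {0..T} \<Longrightarrow> integrable unit_M (v2 t)"
    "\<And>t. t \<in> {0..T} \<Longrightarrow>
      ((\<lambda>s. LINT x|unit_M. \<bar>(u2 s x - u2 t x) / (s - t) - v2 t x\<bar>) \<longlongrightarrow> 0) (at t within {0..T})"
    "\<And>t. t \<in> {0..T} \<Longrightarrow> AE x in unit_M. v2 t x = diffusion_op W2 (u2 t) x"
    by (rule diffusion_solution_L1[OF p sol2]) auto
  have zero: "0 \<in> {0..T}" using t by simp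
  have u1_0: "u1 0 \<in> Lp \<infinity> unit_M"
    using sol1 zero by (auto simp: diffusion_solution_def has_Lp_derivative_on_def)
  have diff: "(\<lambda>(x, y). W2 x y - W1 x y) \<in> Lp \<infinity> square_M"
    using Lp_infinity_diff[OF W2(2) W1(2)] by (simp add: case_prod_unfold)
  have K_nonneg: "0 \<le> K1" "0 \<le> K2" and \<delta>_nonneg: "0 \<le> \<delta>" and U_nonneg: "0 \<le> U"
    and M_nonneg: "0 \<le> M"
    by (simp_all add: K1_def K2_def \<delta>_def U_def M_def)
  note W1_sections = graphon_sections[OF W1, folded K1_def]
  note W2_sections = graphon_sections[OF W2, folded K2_def]

  \<comment> \<open>Without a source, that is with \<open>C = 0\<close>, the comparison principle
    says that the essential supremum of \<open>\<bar>u1\<bar>\<close> does not grow.\<close>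
  have u1_bound: "AE x in unit_M. \<bar>u1 t x\<bar> \<le> U" if "t \<in> {0..T}" for t
  proof -
    have "AE x in unit_M. \<bar>u1 t x\<bar> \<le> U + 0 * t"
    proof (rule diffusion_abs_bound[OF K_nonneg(1) W1_sections sol1'(1-3) _ _ that])
      fix t assume "t \<in> {0..T}"
      from sol1'(4)[OF this] show "AE x in unit_M. \<bar>v1 t x - diffusion_op W1 (u1 t) x\<bar> \<le> 0"
        by (auto elim!: eventually_mono)
    qed (use Lp_infinity_AE_le[OF u1_0] in \<open>simp_all add: U_def\<close>)
    thus ?thesis by simp
  qed

  \<comment> \<open>The difference is treated as a solution for \<open>W2\<close>, so the source is
    the kernel difference acting on \<open>u1\<close>, for which a uniform bound is available;
    \<open>u2\<close> is only known to lie in L^p.\<close>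
  have "AE x in unit_M. \<bar>u1 t x - u2 t x\<bar> \<le> M + 2 * U * \<delta> * t"
  proof (rule diffusion_abs_bound[OF K_nonneg(2) W2_sections _ _ _ _ _ t,
        where v = "\<lambda>t x. v1 t x - v2 t x" and w = "\<lambda>t x. u1 t x - u2 t x"])
    fix t assume t: "t \<in> {0..T}"
    show "((\<lambda>s. LINT x|unit_M. \<bar>((u1 s x - u2 s x) - (u1 t x - u2 t x)) / (s - t)
        - (v1 t x - v2 t x)\<bar>) \<longlongrightarrow> 0) (at t within {0..T})"
    \<comment> \<open>The error of the quotient of the difference is bounded in L^1 by the sum of
      the two individual errors.\<close>
    proof (rule Lim_null_comparison)
      show "((\<lambda>s. (LINT x|unit_M. \<bar>(u1 s x - u1 t x) / (s - t) - v1 t x\<bar>)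
          + (LINT x|unit_M. \<bar>(u2 s x - u2 t x) / (s - t) - v2 t x\<bar>)) \<longlongrightarrow> 0) (at t within {0..T})"
        using tendsto_add[OF sol1'(3)[OF t] sol2'(3)[OF t]] by simp
      have "norm (LINT x|unit_M. \<bar>((u1 s x - u2 s x) - (u1 t x - u2 t x)) / (s - t)
          - (v1 t x - v2 t x)\<bar>)
        \<le> (LINT x|unit_M. \<bar>(u1 s x - u1 t x) / (s - t) - v1 t x\<bar>)
          + (LINT x|unit_M. \<bar>(u2 s x - u2 t x) / (s - t) - v2 t x\<bar>)" if s: "s \<in> {0..T}" for s
      proof -
        have "(LINT x|unit_M. \<bar>((u1 s x - u2 s x) - (u1 t x - u2 t x)) / (s - t)
            - (v1 t x - v2 t x)\<bar>)
          \<le> (LINT x|unit_M. \<bar>(u1 s x - u1 t x) / (s - t) - v1 t x\<bar>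
            + \<bar>(u2 s x - u2 t x) / (s - t) - v2 t x\<bar>)"
          using sol1'(1,2) sol2'(1,2) s t
          by (intro integral_mono') (auto simp: diff_divide_distrib add_divide_distrib)
        thus ?thesis using sol1'(1,2) sol2'(1,2) s t by simp
      qed
      thus "\<forall>\<^sub>F s in at t within {0..T}. norm (LINT x|unit_M.
            \<bar>((u1 s x - u2 s x) - (u1 t x - u2 t x)) / (s - t) - (v1 t x - v2 t x)\<bar>)
          \<le> (LINT x|unit_M. \<bar>(u1 s x - u1 t x) / (s - t) - v1 t x\<bar>)
            + (LINT x|unit_M. \<bar>(u2 s x - u2 t x) / (s - t) - v2 t x\<bar>)"
        by (simp add: eventually_at_filter)
    qed
    show "AE x in unit_M. \<bar>v1 t x - v2 t x - diffusion_op W2 (\<lambda>x. u1 t x - u2 t x) x\<bar> \<le> 2 * U * \<delta>"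
      using sol1'(4)[OF t] sol2'(4)[OF t] u1_bound[OF t] Lp_infinity_sections[OF W1(2)]
        Lp_infinity_sections[OF W2(2)] Lp_infinity_sections(2)[OF diff, folded \<delta>_def]
    proof eventually_elim
      case (elim x)
      have diff_le: "AE y in unit_M. \<bar>W1 x y - W2 x y\<bar> \<le> \<delta>"
        using elim(8) by (simp add: abs_minus_commute)
      show ?case
        unfolding elim(1,2)
        by (rule diffusion_op_diff_bound[where ?W1.0 = W1 and ?W2.0 = W2 and x = x,
              OF elim(4-7) sol1'(1)[OF t] sol2'(1)[OF t] diff_le u1_bound[OF t] elim(3)])
    qed
  next
    show "AE x in unit_M. \<bar>u1 0 x - u2 0 x\<bar> \<le> M"
      unfolding M_def using False sol1'(1)[OF zero] sol2'(1)[OF zero]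
      by (intro Lp_infinity_AE_le) (auto simp: Lp_def less_top)
  qed (use sol1'(1,2) sol2'(1,2) in auto)
  hence "Lp_norm \<infinity> unit_M (\<lambda>x. u1 t x - u2 t x) \<le> ennreal (M + 2 * U * \<delta> * t)"
    using sol1'(1)[OF t] sol2'(1)[OF t] by (intro Lp_norm_infinity_le) auto
  also have "\<dots> = ennreal M + ennreal (2 * t) * ennreal U * ennreal \<delta>"
    using M_nonneg U_nonneg \<delta>_nonneg t by (simp add: mult_ac flip: ennreal_plus ennreal_mult)
  also have "ennreal M = Lp_norm \<infinity> unit_M (\<lambda>x. u1 0 x - u2 0 x)"
    using False by (simp add: M_def less_top)
  also have "ennreal U = Lp_norm \<infinity> unit_M (u1 0)"
    using u1_0 by (simp add: U_def Lp_def)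
  also have "ennreal \<delta> = Lp_norm \<infinity> square_M (\<lambda>(x, y). W2 x y - W1 x y)"
    using diff by (simp add: \<delta>_def Lp_def)
  finally show ?thesis .
qed simp

theorem theorem3p6:
  fixes p :: ennreal and T :: real
    and A :: "nat \<Rightarrow> nat \<Rightarrow> nat \<Rightarrow> real"
    and Wn :: "nat \<Rightarrow> real \<Rightarrow> real \<Rightarrow> real" and W :: "real \<Rightarrow> real \<Rightarrow> real"
    and un :: "nat \<Rightarrow> real \<Rightarrow> real \<Rightarrow> real" and u :: "real \<Rightarrow> real \<Rightarrow> real"
  assumes "1 \<le> p" and "p < \<infinity>" and "T > 0"
    and "\<And>n. n \<ge> 1 \<Longrightarrow> simple_weighted_graph n (A n)"
    and "\<And>n. n \<ge> 1 \<Longrightarrow> Wn n = step_graphon n (A n)"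
    and "\<And>n. n \<ge> 1 \<Longrightarrow> graphon (Wn n)"
    and "graphon W"
    and "\<And>n. n \<ge> 1 \<Longrightarrow> (\<lambda>(x, y). Wn n x y) \<in> Lp \<infinity> square_M"
    and "(\<lambda>(x, y). W x y) \<in> Lp \<infinity> square_M"
    and "(\<lambda>n. Lp_norm \<infinity> square_M (\<lambda>(x, y). Wn n x y - W x y)) \<longlonglongrightarrow> 0"
    and "\<And>n. n \<ge> 1 \<Longrightarrow> diffusion_solution p T (Wn n) (un n)"
    and "diffusion_solution \<infinity> T W u"
  shows "\<forall>n\<ge>1. \<forall>t\<in>{0..T}.
    Lp_norm \<infinity> unit_M (\<lambda>x. u t x - un n t x)
      \<le> Lp_norm \<infinity> unit_M (\<lambda>x. u 0 x - un n 0 x)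
        + ennreal (2 * t) * Lp_norm \<infinity> unit_M (u 0)
          * Lp_norm \<infinity> square_M (\<lambda>(x, y). Wn n x y - W x y)"
proof (intro allI impI ballI)
  fix n :: nat and t :: real
  assume "n \<ge> 1" "t \<in> {0..T}"
  thus "Lp_norm \<infinity> unit_M (\<lambda>x. u t x - un n t x)
      \<le> Lp_norm \<infinity> unit_M (\<lambda>x. u 0 x - un n 0 x)
        + ennreal (2 * t) * Lp_norm \<infinity> unit_M (u 0)
          * Lp_norm \<infinity> square_M (\<lambda>(x, y). Wn n x y - W x y)"
    using assms by (intro diffusion_stability) auto
qed

end
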